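(* Let $\Psi\in\mathcal{H}=\mathbb{C}^N\otimes\mathbb{C}^N$ be a unit vector, let $s$ be an eigenvalue of $S=A_1+A_2$ with $p(s)>0$, and let $\Psi_s=\Pi_s\Psi/\sqrt{p(s)}$. Then for every function $f:\{a_1,\dots,a_N\}\to\mathbb{R}$, $$\langle\Psi_s,f(A_1)\Psi_s\rangle=\sum_{n=1}^N f(a_n)\,\frac{q_\Psi(a_n,s-a_n)}{p(s)}\,\chi(a_n,s).$$ That is, the distribution of the values of $A_1$ in the post-measurement state $\Psi_s$ is the conditional distribution, given that the sum of the two coordinates equals $s$, of the first coordinate under the joint probability distribution $q_\Psi$ on $\{a_1,\dots,a_N\}^2$.
   Context: $A$ is a Hermitian $N\times N$ matrix with $N$ distinct eigenvalues $a_1<\dots<a_N$ and corresponding orthonormal eigenvectors $|a_1\rangle,\dots,|a_N\rangle$ of $\mathbb{C}^N$. On $\mathcal{H}=\mathbb{C}^N\otimes\mathbb{C}^N$ put $A_1=A\otimes I$, $A_2=I\otimes A$, $S=A_1+A_2$, and $|a_n,a_m\rangle=|a_n\rangle\otimes|a_m\rangle$. For a unit vector $\Psi\in\mathcal{H}$, $q_\Psi(a_n,a_m)=|\langle a_n,a_m|\Psi\rangle|^2$ (the joint probability of observing $(a_n,a_m)$ for $(A_1,A_2)$). For an eigenvalue $s$ of $S$, $\chi(a_n,s)=1$ if there is an $m$ with $a_n+a_m=s$ and $\chi(a_n,s)=0$ otherwise; terms with $\chi(a_n,s)=0$ are read as $0$. $\Pi_s=\sum_{(n,m):\,a_n+a_m=s}|a_n,a_m\rangle\langle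 a_n,a_m|$ is the orthogonal projection onto the eigenspace of $S$ for $s$, and $p(s)=\sum_{(n,m):\,a_n+a_m=s}q_\Psi(a_n,a_m)=\langle\Psi,\Pi_s\Psi\rangle$. $f(A_1)$ is defined by functional calculus, $f(A_1)|a_n,a_m\rangle=f(a_n)|a_n,a_m\rangle$. *)

theory Defs
  imports "HOL-Probability.Probability"
begin

text \<open>
  \<open>\<complex>\<^sup>N\<close> is \<^typ>\<open>complex ^ 'n\<close> with \<open>CARD('n) = N\<close>, and \<open>\<complex>\<^sup>N \<otimes> \<complex>\<^sup>N\<close> is
  \<^typ>\<open>complex ^ ('n \<times> 'n)\<close>. The library norm on these types is the Hermitian norm, but the
  library inner product is the real one.
\<close>

definition cinner :: "complex ^ 'n \<Rightarrow> complex ^ 'n \<Rightarrow> complex" where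
  "cinner x y = (\<Sum>i\<in>UNIV. cnj (x $ i) * y $ i)"

definition hermitian :: "complex ^ 'n ^ 'n \<Rightarrow> bool" where
  "hermitian M \<longleftrightarrow> (\<forall>i j. M $ i $ j = cnj (M $ j $ i))"

definition eigenvalue :: "complex ^ 'n ^ 'n \<Rightarrow> complex \<Rightarrow> bool" where
  "eigenvalue M c \<longleftrightarrow> (\<exists>x. x \<noteq> 0 \<and> M *v x = c *s x)"

definition tensor_vec :: "complex ^ 'n \<Rightarrow> complex ^ 'm \<Rightarrow> complex ^ ('n \<times> 'm)" where
  "tensor_vec x y = (\<chi> i. x $ fst i * y $ snd i)"

definition tensor_mat ::
  "complex ^ 'n ^ 'n \<Rightarrow> complex ^ 'm ^ 'm \<Rightarrow> complex ^ ('n \<times> 'm) ^ ('n \<times> 'm)" where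
  "tensor_mat A B = (\<chi> i j. A $ fst i $ fst j * B $ snd i $ snd j)"

definition op_A1 :: "complex ^ 'n ^ 'n \<Rightarrow> complex ^ ('n \<times> 'n) ^ ('n \<times> 'n)" where
  "op_A1 A = tensor_mat A (mat 1)"

definition op_A2 :: "complex ^ 'n ^ 'n \<Rightarrow> complex ^ ('n \<times> 'n) ^ ('n \<times> 'n)" where
  "op_A2 A = tensor_mat (mat 1) A"

definition op_S :: "complex ^ 'n ^ 'n \<Rightarrow> complex ^ ('n \<times> 'n) ^ ('n \<times> 'n)" where
  "op_S A = op_A1 A + op_A2 A"

text \<open>The rank-one operator \<open>|x\<rangle>\<langle>x|\<close>.\<close>

definition ketbra :: "complex ^ 'n \<Rightarrow> complex ^ 'n ^ 'n" where
  "ketbra x = (\<chi> i j. x $ i * cnj (x $ j))"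

text \<open>
  Below, \<open>a n\<close> and \<open>v n\<close> for \<open>n \<in> {1..N}\<close> are the eigenvalues and eigenvectors of \<open>A\<close>.
\<close>

definition ket :: "(nat \<Rightarrow> complex ^ 'n) \<Rightarrow> nat \<Rightarrow> nat \<Rightarrow> complex ^ ('n \<times> 'n)" where
  "ket v n m = tensor_vec (v n) (v m)"

definition pairs_with_sum :: "nat \<Rightarrow> (nat \<Rightarrow> real) \<Rightarrow> real \<Rightarrow> (nat \<times> nat) set" where
  "pairs_with_sum N a s = {(n, m). n \<in> {1..N} \<and> m \<in> {1..N} \<and> a n + a m = s}"

text \<open>
  The joint probability \<open>q\<^sub>\<Psi>(x, y)\<close> as a function of the observed values: if \<open>a\<close> is injective on
  \<open>{1..N}\<close> the sum has the single term \<open>x = a n, y = a m\<close> when \<open>x\<close> and \<open>y\<close> are eigenvalues, and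
  it is empty otherwise, so that \<open>q\<^sub>\<Psi>\<close> is extended by zero.
\<close>

definition joint_prob ::
  "nat \<Rightarrow> (nat \<Rightarrow> real) \<Rightarrow> (nat \<Rightarrow> complex ^ 'n) \<Rightarrow> complex ^ ('n \<times> 'n) \<Rightarrow> real \<Rightarrow> real \<Rightarrow> real" where
  "joint_prob N a v \<Psi> x y =
     (\<Sum>(n, m) | n \<in> {1..N} \<and> m \<in> {1..N} \<and> a n = x \<and> a m = y. (cmod (cinner (ket v n m) \<Psi>))\<^sup>2)"

definition joint_dist ::
  "nat \<Rightarrow> (nat \<Rightarrow> real) \<Rightarrow> (nat \<Rightarrow> complex ^ 'n) \<Rightarrow> complex ^ ('n \<times> 'n) \<Rightarrow> (real \<times> real) measure" where
  "joint_dist N a v \<Psi> =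
     point_measure (a ` {1..N} \<times> a ` {1..N}) (\<lambda>(x, y). ennreal (joint_prob N a v \<Psi> x y))"

definition chi :: "nat \<Rightarrow> (nat \<Rightarrow> real) \<Rightarrow> real \<Rightarrow> real \<Rightarrow> real" where
  "chi N a x s = (if \<exists>m\<in>{1..N}. x + a m = s then 1 else 0)"

definition sum_proj ::
  "nat \<Rightarrow> (nat \<Rightarrow> real) \<Rightarrow> (nat \<Rightarrow> complex ^ 'n) \<Rightarrow> real \<Rightarrow> complex ^ ('n \<times> 'n) ^ ('n \<times> 'n)" where
  "sum_proj N a v s = (\<Sum>(n, m)\<in>pairs_with_sum N a s. ketbra (ket v n m))"

definition sum_prob ::
  "nat \<Rightarrow> (nat \<Rightarrow> real) \<Rightarrow> (nat \<Rightarrow> complex ^ 'n) \<Rightarrow> complex ^ ('n \<times> 'n) \<Rightarrow> real \<Rightarrow> real" where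
  "sum_prob N a v \<Psi> s = (\<Sum>(n, m)\<in>pairs_with_sum N a s. joint_prob N a v \<Psi> (a n) (a m))"

definition post_state ::
  "nat \<Rightarrow> (nat \<Rightarrow> real) \<Rightarrow> (nat \<Rightarrow> complex ^ 'n) \<Rightarrow> complex ^ ('n \<times> 'n) \<Rightarrow> real
     \<Rightarrow> complex ^ ('n \<times> 'n)" where
  "post_state N a v \<Psi> s = (sum_proj N a v s *v \<Psi>) /\<^sub>R sqrt (sum_prob N a v \<Psi> s)"

text \<open>
  \<open>f(A\<^sub>1)\<close> in its spectral form; only the values of \<open>f\<close> on \<open>{a 1, \<dots>, a N}\<close> matter.
  Lemmas \<open>fun_A1_ket\<close> and \<open>op_A1_ket\<close> below give its action on the basis, to be compared
  with that of \<open>A\<^sub>1\<close>.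
\<close>

definition fun_A1 ::
  "nat \<Rightarrow> (nat \<Rightarrow> real) \<Rightarrow> (nat \<Rightarrow> complex ^ 'n) \<Rightarrow> (real \<Rightarrow> real)
     \<Rightarrow> complex ^ ('n \<times> 'n) ^ ('n \<times> 'n)" where
  "fun_A1 N a v f = (\<Sum>n=1..N. \<Sum>m=1..N. f (a n) *\<^sub>R ketbra (ket v n m))"

lemma sum_UNIV_prod:
  fixes g :: "'a::finite \<times> 'b::finite \<Rightarrow> 'c::comm_monoid_add"
  shows "(\<Sum>p\<in>UNIV. g p) = (\<Sum>i\<in>UNIV. \<Sum>j\<in>UNIV. g (i, j))"
  by (simp add: sum.cartesian_product flip: UNIV_Times_UNIV)

lemma cinner_tensor_vec:
  "cinner (tensor_vec x y) (tensor_vec x' y') = cinner x x' * cinner y y'"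
  unfolding cinner_def tensor_vec_def sum_UNIV_prod
  by (simp add: sum_product algebra_simps)

lemma tensor_mat_tensor_vec:
  "tensor_mat A B *v tensor_vec x y = tensor_vec (A *v x) (B *v y)"
  unfolding vec_eq_iff matrix_vector_mult_def tensor_mat_def tensor_vec_def
    sum_UNIV_prod
  by (simp add: sum_product algebra_simps)

lemma ketbra_mult: "ketbra x *v y = cinner x y *s x"
  by (simp add: vec_eq_iff matrix_vector_mult_def ketbra_def cinner_def sum_distrib_right
      sum_distrib_left algebra_simps)

lemma cinner_ket:
  assumes "\<And>n m. n \<in> {1..N} \<Longrightarrow> m \<in> {1..N} \<Longrightarrow> cinner (v n) (v m) = (if n = m then 1 else 0)"
    and "n \<in> {1..N}" "m \<in> {1..N}" "k \<in> {1..N}" "l \<in> {1..N}"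
  shows "cinner (ket v n m) (ket v k l) = (if n = k \<and> m = l then 1 else 0)"
  using assms by (simp add: ket_def cinner_tensor_vec)

lemma sum_matrix_vector_mult:
  fixes M :: "'i \<Rightarrow> complex ^ 'n ^ 'm"
  shows "(\<Sum>i\<in>I. M i) *v x = (\<Sum>i\<in>I. M i *v x)"
  by (induction I rule: infinite_finite_induct) (auto simp: matrix_vector_mult_add_rdistrib)

lemma scaleR_matrix_vector_mult:
  fixes M :: "complex ^ 'n ^ 'm"
  shows "(c *\<^sub>R M) *v x = c *\<^sub>R (M *v x)"
  by (simp add: vec_eq_iff matrix_vector_mult_def scaleR_sum_right)

lemma op_A1_ket:
  assumes "A *v v n = complex_of_real (a n) *s v n"
  shows "op_A1 A *v ket v n m = complex_of_real (a n) *s ket v n m"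
  unfolding op_A1_def ket_def tensor_mat_tensor_vec assms
  by (simp add: tensor_vec_def vec_eq_iff)

lemma op_S_ket:
  assumes "A *v v n = complex_of_real (a n) *s v n" "A *v v m = complex_of_real (a m) *s v m"
  shows "op_S A *v ket v n m = complex_of_real (a n + a m) *s ket v n m"
  unfolding op_S_def op_A1_def op_A2_def ket_def matrix_vector_mult_add_rdistrib
    tensor_mat_tensor_vec assms
  by (simp add: tensor_vec_def vec_eq_iff algebra_simps)

lemma fun_A1_ket:
  assumes orth: "\<And>n m. n \<in> {1..N} \<Longrightarrow> m \<in> {1..N} \<Longrightarrow>
      cinner (v n) (v m) = (if n = m then 1 else 0)"
    and k: "k \<in> {1..N}" and l: "l \<in> {1..N}"
  shows "fun_A1 N a v f *v ket v k l = complex_of_real (f (a k)) *s ket v k l"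
proof -
  have "fun_A1 N a v f *v ket v k l =
      (\<Sum>n=1..N. \<Sum>m=1..N. f (a n) *\<^sub>R (cinner (ket v n m) (ket v k l) *s ket v n m))"
    by (simp add: fun_A1_def sum_matrix_vector_mult scaleR_matrix_vector_mult ketbra_mult)
  also have "\<dots> = (\<Sum>n=1..N. \<Sum>m=1..N. if n = k then if m = l then f (a n) *\<^sub>R ket v n m else 0 else 0)"
  proof (intro sum.cong refl)
    fix n m assume nm: "n \<in> {1..N}" "m \<in> {1..N}"
    have "cinner (ket v n m) (ket v k l) = (if n = k \<and> m = l then 1 else 0)"
      using orth nm k l by (rule cinner_ket)
    then show "f (a n) *\<^sub>R (cinner (ket v n m) (ket v k l) *s ket v n m) =
        (if n = k then if m = l then f (a n) *\<^sub>R ket v n m else 0 else 0)"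
      by simp
  qed
  also have "\<dots> = (\<Sum>n=1..N. if n = k then f (a n) *\<^sub>R ket v n l else 0)"
    using l by (intro sum.cong refl) auto
  also have "\<dots> = f (a k) *\<^sub>R ket v k l"
    using k by simp
  also have "\<dots> = complex_of_real (f (a k)) *s ket v k l"
    unfolding vec_eq_iff by (simp only: vector_scaleR_component vector_smult_component) (simp add: scaleR_conv_of_real[where 'a=complex])
  finally show ?thesis .
qed

end

theory Submission
  imports Defs
begin

text \<open>
  Expanding in the orthonormal eigenbasis, the expectation of \<open>f(A\<^sub>1)\<close> in a vector weights \<open>f(a\<^sub>n)\<close> by
  the squared amplitudes on \<open>|a\<^sub>n, a\<^sub>m\<rangle>\<close>. Projecting with \<open>\<Pi>\<^sub>s\<close> keeps the amplitudes with
  \<open>a\<^sub>n + a\<^sub>m = s\<close> and kills all others; since the eigenvalues are distinct, at most one \<open>m\<close>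
  contributes for each \<open>n\<close>.
\<close>

lemma cinner_sum_right: "cinner x (\<Sum>i\<in>I. y i) = (\<Sum>i\<in>I. cinner x (y i))"
  by (induction I rule: infinite_finite_induct) (auto simp: cinner_def distrib_left sum.distrib)

lemma cinner_smult_right: "cinner x (c *s y) = c * cinner x y"
  by (simp add: cinner_def sum_distrib_left algebra_simps)

lemma cinner_scaleR_right: "cinner x (r *\<^sub>R y) = complex_of_real r * cinner x y"
  by (simp add: cinner_def sum_distrib_left scaleR_conv_of_real[where 'a=complex] algebra_simps)

lemma cinner_commute: "cinner y x = cnj (cinner x y)"
  by (simp add: cinner_def mult.commute)

text \<open>The identity holds term by term: \<open>ketbra (ket v n m)\<close> contributes an
  amplitude times its conjugate, which is the squared modulus.\<close>

lemma cinner_fun_A1: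
  "cinner x (fun_A1 N a v f *v x) =
    complex_of_real (\<Sum>n=1..N. \<Sum>m=1..N. f (a n) * (cmod (cinner (ket v n m) x))\<^sup>2)"
proof -
  have "cinner (ket v n m) x * cinner x (ket v n m) = complex_of_real ((cmod (cinner (ket v n m) x))\<^sup>2)"
    for n m
    \<comment> \<open>Only the second factor is reversed, so that the product takes the shape
      \<open>z * cnj z\<close>.\<close>
    by (subst (2) cinner_commute) (simp only: complex_norm_square)
  then show ?thesis
    by (simp add: fun_A1_def sum_matrix_vector_mult scaleR_matrix_vector_mult ketbra_mult
        cinner_sum_right cinner_scaleR_right cinner_smult_right)
qed

lemma finite_pairs_with_sum: "finite (pairs_with_sum N a s)"
  by (rule finite_subset[of _ "{1..N} \<times> {1..N}"]) (auto simp: pairs_with_sum_def)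

text \<open>Orthonormality leaves only the summand with index \<open>(n, m)\<close>, and this index
  lies in \<open>pairs_with_sum N a s\<close> exactly when the two eigenvalues add up to
  \<open>s\<close>.\<close>

lemma cinner_ket_sum_proj:
  assumes orth: "\<And>n m. n \<in> {1..N} \<Longrightarrow> m \<in> {1..N} \<Longrightarrow> cinner (v n) (v m) = (if n = m then 1 else 0)"
    and nm: "n \<in> {1..N}" "m \<in> {1..N}"
  shows "cinner (ket v n m) (sum_proj N a v s *v \<Psi>) =
    (if a n + a m = s then cinner (ket v n m) \<Psi> else 0)"
proof -
  have "cinner (ket v n m) (sum_proj N a v s *v \<Psi>) =
      (\<Sum>p\<in>pairs_with_sum N a s.
        cinner (ket v (fst p) (snd p)) \<Psi> * cinner (ket v n m) (ket v (fst p) (snd p)))"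
    by (simp add: sum_proj_def sum_matrix_vector_mult ketbra_mult cinner_sum_right
        cinner_smult_right case_prod_beta)
  also have "\<dots> = (\<Sum>p\<in>pairs_with_sum N a s. if p = (n, m) then cinner (ket v n m) \<Psi> else 0)"
  proof (intro sum.cong refl)
    fix p assume "p \<in> pairs_with_sum N a s"
    then have "fst p \<in> {1..N}" "snd p \<in> {1..N}"
      by (auto simp: pairs_with_sum_def)
    then have "cinner (ket v n m) (ket v (fst p) (snd p)) = (if n = fst p \<and> m = snd p then 1 else 0)"
      using cinner_ket[OF orth nm] by blast
    then show "cinner (ket v (fst p) (snd p)) \<Psi> * cinner (ket v n m) (ket v (fst p) (snd p)) =
        (if p = (n, m) then cinner (ket v n m) \<Psi> else 0)"
      by auto
  qed
  also have "\<dots> = (if a n + a m = s then cinner (ket v n m) \<Psi> else 0)"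
    using nm by (simp add: finite_pairs_with_sum) (simp add: pairs_with_sum_def)
  finally show ?thesis .
qed

lemma joint_prob_nonneg: "joint_prob N a v \<Psi> x y \<ge> 0"
  unfolding joint_prob_def by (intro sum_nonneg) auto

text \<open>Distinctness of the eigenvalues forces the first index to be \<open>n\<close>. The
  condition on \<open>m\<close> stays inside the sum, the form in which the amplitudes of the
  post-measurement state appear.\<close>

lemma joint_prob_eigenvalue:
  assumes "inj_on a {1..N}" "n \<in> {1..N}"
  shows "joint_prob N a v \<Psi> (a n) y =
    (\<Sum>m=1..N. if a m = y then (cmod (cinner (ket v n m) \<Psi>))\<^sup>2 else 0)"
proof -
  have "{(k, m). k \<in> {1..N} \<and> m \<in> {1..N} \<and> a k = a n \<and> a m = y} = Pair n ` {m \<in> {1..N}. a m = y}"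
    using assms by (auto dest: inj_onD)
  then show ?thesis
    by (simp add: joint_prob_def sum.reindex inj_on_def sum.inter_filter[symmetric] del: atLeastAtMost_iff)
qed

text \<open>When \<open>s - x\<close> is not an eigenvalue, the sum defining
  \<open>joint_prob\<close> is empty. The extension by zero thus already does the work of the factor
  \<open>chi\<close>.\<close>

lemma joint_prob_chi:
  "joint_prob N a v \<Psi> x (s - x) * chi N a x s = joint_prob N a v \<Psi> x (s - x)"
proof (cases "\<exists>m\<in>{1..N}. x + a m = s")
  case False
  then have "{(n, m). n \<in> {1..N} \<and> m \<in> {1..N} \<and> a n = x \<and> a m = s - x} = {}"
    by (auto simp: algebra_simps)
  then show ?thesis
    by (simp only: joint_prob_def sum.empty mult_zero_left)
qed (auto simp: chi_def)

text \<open>For fixed \<open>n\<close>, the squared amplitudes of the post-measurement state, summed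
  over \<open>m\<close>, give the joint probability at \<open>(a n, s - a n)\<close> divided by the
  normalisation.\<close>

lemma cinner_post_state_fun_A1:
  assumes orth: "\<And>n m. n \<in> {1..N} \<Longrightarrow> m \<in> {1..N} \<Longrightarrow> cinner (v n) (v m) = (if n = m then 1 else 0)"
    and inj: "inj_on a {1..N}"
    and pos: "sum_prob N a v \<Psi> s > 0"
  shows "cinner (post_state N a v \<Psi> s) (fun_A1 N a v f *v post_state N a v \<Psi> s) =
    complex_of_real (\<Sum>n=1..N. f (a n) * (joint_prob N a v \<Psi> (a n) (s - a n) / sum_prob N a v \<Psi> s))"
proof -
  let ?p = "sum_prob N a v \<Psi> s"
  have amplitude: "(cmod (cinner (ket v n m) (post_state N a v \<Psi> s)))\<^sup>2 =
      (if a m = s - a n then (cmod (cinner (ket v n m) \<Psi>))\<^sup>2 else 0) / ?p"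
    if "n \<in> {1..N}" "m \<in> {1..N}" for n m
  proof -
    have "cinner (ket v n m) (post_state N a v \<Psi> s) =
        complex_of_real (inverse (sqrt ?p)) * (if a n + a m = s then cinner (ket v n m) \<Psi> else 0)"
      by (simp only: post_state_def cinner_scaleR_right cinner_ket_sum_proj[where a = a, OF orth that])
    then have "(cmod (cinner (ket v n m) (post_state N a v \<Psi> s)))\<^sup>2 =
        (inverse (sqrt ?p))\<^sup>2 * (if a n + a m = s then (cmod (cinner (ket v n m) \<Psi>))\<^sup>2 else 0)"
      by (simp add: norm_mult norm_inverse power_mult_distrib power_inverse)
    \<comment> \<open>Positivity of \<open>?p\<close> makes squaring undo the root, so the
      normalised state yields the denominator of a conditional probability.\<close>
    also have "(inverse (sqrt ?p))\<^sup>2 = inverse ?p"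
      using pos by (simp add: power_inverse)
    also have "a n + a m = s \<longleftrightarrow> a m = s - a n"
      by auto
    finally show ?thesis
      by (simp only: divide_inverse mult.commute)
  qed
  show ?thesis
    unfolding cinner_fun_A1 of_real_eq_iff
  proof (intro sum.cong refl)
    fix n assume n: "n \<in> {1..N}"
    have "(\<Sum>m=1..N. f (a n) * (cmod (cinner (ket v n m) (post_state N a v \<Psi> s)))\<^sup>2) =
        f (a n) * ((\<Sum>m=1..N. if a m = s - a n then (cmod (cinner (ket v n m) \<Psi>))\<^sup>2 else 0) / ?p)"
      using n amplitude by (simp only: sum_distrib_left sum_divide_distrib cong: sum.cong)
    then show "(\<Sum>m=1..N. f (a n) * (cmod (cinner (ket v n m) (post_state N a v \<Psi> s)))\<^sup>2) =
        f (a n) * (joint_prob N a v \<Psi> (a n) (s - a n) / ?p)"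
      by (simp only: joint_prob_eigenvalue[OF inj n])
  qed
qed

lemma measure_joint_dist:
  assumes "X \<subseteq> a ` {1..N} \<times> a ` {1..N}"
  shows "measure (joint_dist N a v \<Psi>) X = (\<Sum>(x, y)\<in>X. joint_prob N a v \<Psi> x y)"
proof -
  have "emeasure (joint_dist N a v \<Psi>) X = (\<Sum>z\<in>X. ennreal (joint_prob N a v \<Psi> (fst z) (snd z)))"
    using assms unfolding joint_dist_def
    by (subst emeasure_point_measure_finite) (auto simp: case_prod_beta)
  also have "\<dots> = ennreal (\<Sum>z\<in>X. joint_prob N a v \<Psi> (fst z) (snd z))"
    by (intro sum_ennreal joint_prob_nonneg)
  finally show ?thesis
    by (simp add: measure_def case_prod_beta sum_nonneg joint_prob_nonneg)
qed

text \<open>Numerator and denominator of the conditional probability are finite sums of point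
  masses; the denominator adds up to \<open>sum_prob\<close>.\<close>

lemma cond_prob_joint_dist:
  assumes inj: "inj_on a {1..N}" and n: "n \<in> {1..N}"
  shows "\<P>(z in joint_dist N a v \<Psi>. fst z = a n \<bar> fst z + snd z = s) =
    joint_prob N a v \<Psi> (a n) (s - a n) / sum_prob N a v \<Psi> s"
proof -
  let ?M = "joint_dist N a v \<Psi>" and ?E = "a ` {1..N} \<times> a ` {1..N}"
  have space: "space ?M = ?E"
    by (simp add: joint_dist_def space_point_measure)
  have "measure ?M {z \<in> ?E. fst z + snd z = s} =
      (\<Sum>(x, y)\<in>map_prod a a ` pairs_with_sum N a s. joint_prob N a v \<Psi> x y)"
    by (subst measure_joint_dist) (auto simp: pairs_with_sum_def intro!: sum.cong)
  also have "\<dots> = sum_prob N a v \<Psi> s"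
  proof -
    \<comment> \<open>Since the eigenvalues are distinct, pairs of values correspond one to one to
      pairs of indices, and the sum can be reindexed.\<close>
    have "inj_on (map_prod a a) (pairs_with_sum N a s)"
      using map_prod_inj_on[OF inj inj] by (rule inj_on_subset) (auto simp: pairs_with_sum_def)
    then show ?thesis
      by (simp add: sum_prob_def sum.reindex case_prod_beta)
  qed
  finally have denominator: "measure ?M {z \<in> ?E. fst z + snd z = s} = sum_prob N a v \<Psi> s" .
  \<comment> \<open>The first coordinate and the sum determine the second, so the event is a single
    point or empty; \<open>chi\<close> tells which.\<close>
  have "{z \<in> ?E. fst z = a n \<and> fst z + snd z = s} =
      (if \<exists>m\<in>{1..N}. a n + a m = s then {(a n, s - a n)} else {})"
    using n by auto
  then have "measure ?M {z \<in> ?E. fst z = a n \<and> fst z + snd z = s} =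
      joint_prob N a v \<Psi> (a n) (s - a n) * chi N a (a n) s"
    using n by (subst measure_joint_dist) (auto simp: chi_def)
  then show ?thesis
    by (simp only: cond_prob_def space denominator joint_prob_chi)
qed

theorem mainTheorem3:
  fixes N :: nat
    and A :: "complex ^ 'n ^ 'n"
    and a :: "nat \<Rightarrow> real"
    and v :: "nat \<Rightarrow> complex ^ 'n"
    and \<Psi> :: "complex ^ ('n \<times> 'n)"
    and s :: real
  assumes "CARD('n) = N"
    and "hermitian A"
    and "strict_mono_on {1..N} a"
    and "\<And>n. n \<in> {1..N} \<Longrightarrow> A *v v n = complex_of_real (a n) *s v n"
    and "\<And>n m. n \<in> {1..N} \<Longrightarrow> m \<in> {1..N} \<Longrightarrow> cinner (v n) (v m) = (if n = m then 1 else 0)"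
    and "norm \<Psi> = 1"
    and "eigenvalue (op_S A) (complex_of_real s)"
    and "sum_prob N a v \<Psi> s > 0"
  shows "(\<forall>f :: real \<Rightarrow> real.
           cinner (post_state N a v \<Psi> s) (fun_A1 N a v f *v post_state N a v \<Psi> s) =
           complex_of_real (\<Sum>n=1..N.
             f (a n) * (joint_prob N a v \<Psi> (a n) (s - a n) / sum_prob N a v \<Psi> s) * chi N a (a n) s))
       \<and> (\<forall>n\<in>{1..N}.
           cinner (post_state N a v \<Psi> s) (fun_A1 N a v (indicator {a n}) *v post_state N a v \<Psi> s) =
           complex_of_real
             (\<P>(z in joint_dist N a v \<Psi>. fst z = a n \<bar> fst z + snd z = s)))"
proof -
  have inj: "inj_on a {1..N}"
    using assms(3) by (rule strict_mono_on_imp_inj_on)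
  note expectation = cinner_post_state_fun_A1[where a = a, OF assms(5) inj assms(8)]
  \<comment> \<open>With the indicator of \<open>{a n}\<close> as \<open>f\<close>, the expectation
    is the probability of observing \<open>a n\<close>; by injectivity only \<open>k = n\<close>
    survives.\<close>
  have "(\<Sum>k=1..N. indicator {a n} (a k) *
        (joint_prob N a v \<Psi> (a k) (s - a k) / sum_prob N a v \<Psi> s)) =
      \<P>(z in joint_dist N a v \<Psi>. fst z = a n \<bar> fst z + snd z = s)" if n: "n \<in> {1..N}" for n
  proof -
    have "(\<Sum>k=1..N. indicator {a n} (a k) *
          (joint_prob N a v \<Psi> (a k) (s - a k) / sum_prob N a v \<Psi> s)) =
        (\<Sum>k=1..N. if k = n then joint_prob N a v \<Psi> (a n) (s - a n) / sum_prob N a v \<Psi> s else 0)"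
      using inj n by (intro sum.cong) (auto simp: indicator_def dest: inj_onD)
    then show ?thesis
      using n by (simp add: cond_prob_joint_dist[OF inj n])
  qed
  \<comment> \<open>The factor \<open>chi\<close> from the stated formula is absorbed by the joint
    probability.\<close>
  moreover have "f (a n) * (joint_prob N a v \<Psi> (a n) (s - a n) / sum_prob N a v \<Psi> s) * chi N a (a n) s =
      f (a n) * (joint_prob N a v \<Psi> (a n) (s - a n) / sum_prob N a v \<Psi> s)" for f n
    using joint_prob_chi[of N a v \<Psi> "a n" s]
    by (simp only: times_divide_eq_left times_divide_eq_right mult.assoc)
  ultimately show ?thesis
    by (auto simp only: expectation)
qed

end
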